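(* Let $s\ge 1$ be an integer and let $a_1,\dots,a_s,b_1,\dots,b_s\in\mathbb{R}$. For square matrices $A,B$ of the same size and $\tau\in\mathbb{R}$ put $$\mathcal{S}_{A,B}(\tau)=e^{b_s\tau B}e^{a_s\tau A}\cdots e^{b_1\tau B}e^{a_1\tau A}.$$ Suppose that the method $\mathcal{S}$ is of order $p$ for some integer $p\ge 5$ when applied to problems with $[B,[B,A]]=0$, i.e. for every $d\ge 1$ and all real or complex $d\times d$ matrices $A,B$ satisfying $[B,[B,A]]=0$ one has $$\mathcal{S}_{A,B}(\tau)=e^{\tau(A+B)}+O(\tau^{p+1})\quad\text{as }\tau\to 0.$$ Then at least one of the coefficients $a_1,\dots,a_s$ is strictly negative.
   Context: $[X,Y]=XY-YX$ denotes the matrix commutator and $e^X$ the matrix exponential. The product is ordered so that the index decreases from $s$ (leftmost) to $1$ (rightmost). The method is a one-step integrator $y_{n+1}=\mathcal{S}(\tau)y_n$ for linear evolution equations $\partial_t y=Ay+By$ on $\mathbb{R}^d$ or $\mathbb{C}^d$. The coefficients $a_j,b_j$ are fixed and do not depend on $d$, $A$, $B$ or $\tau$. Being of order $p$ means that the error estimate $O(\tau^{p+1})$ holds for all problems in the indicated class, where the constant in $O(\cdot)$ may depend on $A$ and $B$. *)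

theory Defs
  imports
    Complex_Main
    "HOL-Library.Landau_Symbols"
    "Jordan_Normal_Form.Matrix"
begin

text \<open>The dimension has to be quantified inside a hypothesis, hence matrices with an explicit
  carrier. The matrix exponential is the entrywise sum of the exponential series, which is
  convergent by \<open>mat_exp_sums\<close> below.\<close>

definition mat_exp :: "'a::{real_normed_field,banach} mat \<Rightarrow> 'a mat" where
  "mat_exp X = mat (dim_row X) (dim_row X) (\<lambda>(i, j). \<Sum>k. (X ^\<^sub>m k) $$ (i, j) / fact k)"

definition commutator :: "'a::ring mat \<Rightarrow> 'a mat \<Rightarrow> 'a mat" where
  "commutator X Y = X * Y - Y * X"

primrec splitting ::
  "(nat \<Rightarrow> real) \<Rightarrow> (nat \<Rightarrow> real) \<Rightarrow> 'a::{real_normed_field,banach} mat \<Rightarrow> 'a mat \<Rightarrow> real \<Rightarrow> nat \<Rightarrow> 'a mat"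
where
  "splitting a b A B \<tau> 0 = 1\<^sub>m (dim_row A)"
| "splitting a b A B \<tau> (Suc k) =
     mat_exp (of_real (b (Suc k) * \<tau>) \<cdot>\<^sub>m B) * mat_exp (of_real (a (Suc k) * \<tau>) \<cdot>\<^sub>m A)
       * splitting a b A B \<tau> k"

text \<open>Order \<open>p\<close> over the scalar field \<open>'a\<close>, on the class \<open>[B,[B,A]] = 0\<close>. The matrix-valued
  Landau estimate is meant entry by entry, so the constant may depend on \<open>A\<close> and \<open>B\<close>.\<close>

definition has_order_BBA ::
  "'a::{real_normed_field,banach} itself \<Rightarrow> nat \<Rightarrow> (nat \<Rightarrow> real) \<Rightarrow> (nat \<Rightarrow> real) \<Rightarrow> nat \<Rightarrow> bool"
where
  "has_order_BBA TYPE('a) s a b p \<longleftrightarrow>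
     (\<forall>d\<ge>1. \<forall>A\<in>carrier_mat d d. \<forall>B\<in>carrier_mat d d.
        commutator B (commutator B A) = 0\<^sub>m d d \<longrightarrow>
        (\<forall>i<d. \<forall>j<d.
           (\<lambda>\<tau>::real. (splitting a b A B \<tau> s - mat_exp (of_real \<tau> \<cdot>\<^sub>m (A + B))) $$ (i, j) :: 'a)
             \<in> O[at 0](\<lambda>\<tau>. of_real \<tau> ^ (p + 1))))"

lemma pow_mat_entry_bound:
  fixes X :: "'a::{real_normed_field,banach} mat"
  assumes X: "X \<in> carrier_mat d d"
    and M: "\<And>i j. i < d \<Longrightarrow> j < d \<Longrightarrow> norm (X $$ (i, j)) \<le> M"
    and ij: "i < d" "j < d"
  shows "norm ((X ^\<^sub>m k) $$ (i, j)) \<le> (real d * M) ^ k"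
  using ij
proof (induction k arbitrary: i j)
  case 0
  then show ?case using X by auto
next
  case (Suc k)
  have M0: "0 \<le> M" using M[OF Suc.prems] norm_ge_zero order_trans by blast
  have pc: "X ^\<^sub>m k \<in> carrier_mat d d" using X by simp
  have "(X ^\<^sub>m Suc k) $$ (i, j) = (\<Sum>l = 0..<d. (X ^\<^sub>m k) $$ (i, l) * X $$ (l, j))"
    using X pc Suc.prems by (simp add: scalar_prod_def)
  also have "norm \<dots> \<le> (\<Sum>l = 0..<d. (real d * M) ^ k * M)"
    by (rule sum_norm_le)
      (use Suc M M0 in \<open>auto simp: norm_mult intro!: mult_mono\<close>)
  finally show ?case by (simp add: mult_ac)
qed

lemma mat_exp_sums:
  fixes X :: "'a::{real_normed_field,banach} mat"
  assumes X: "X \<in> carrier_mat d d" and ij: "i < d" "j < d"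
  shows "(\<lambda>k. (X ^\<^sub>m k) $$ (i, j) / fact k) sums (mat_exp X $$ (i, j))"
proof -
  define M where "M = (\<Sum>(i, j)\<in>{..<d} \<times> {..<d}. norm (X $$ (i, j)))"
  have M: "norm (X $$ (i, j)) \<le> M" if "i < d" "j < d" for i j
    using member_le_sum[of "(i, j)" "{..<d} \<times> {..<d}" "\<lambda>(i, j). norm (X $$ (i, j))"] that
    by (auto simp: M_def)
  have "summable (\<lambda>k. (X ^\<^sub>m k) $$ (i, j) / fact k)"
  proof (rule summable_comparison_test')
    show "summable (\<lambda>k. inverse (fact k) * (real d * M) ^ k)" by (rule summable_exp)
    show "norm ((X ^\<^sub>m k) $$ (i, j) / fact k) \<le> inverse (fact k) * (real d * M) ^ k"
      if "k \<ge> 0" for k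
      using pow_mat_entry_bound[OF X M ij, of k]
      by (simp add: norm_divide divide_right_mono field_simps)
  qed
  then show ?thesis using X ij by (simp add: mat_exp_def summable_sums)
qed

end

theory Submission
  imports Defs "HOL-Analysis.Equivalence_Lebesgue_Henstock_Integration"
begin

text \<open>
  Write \<open>c\<^sub>k = a\<^sub>1 + \<dots> + a\<^sub>k\<close>. Moving all exponentials of \<open>A\<close> to one side turns the method into a
  product of kicks by \<open>B\<close> at the times \<open>c\<^sub>k\<close> with strengths \<open>b\<^sub>k\<close>; the terms of first degree in
  \<open>B\<close> say that \<open>(b\<^sub>k, c\<^sub>k)\<close> is a quadrature rule on \<open>[0, 1]\<close>, and order \<open>5\<close> makes it exact on
  polynomials of degree at most \<open>4\<close>. If \<open>[B, [B, A]] = 0\<close>, the first condition of second degree in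
  \<open>B\<close> that survives comes from the commutator \<open>[[B, A], [A, [A, B]]]\<close>, which has total degree
  \<open>5\<close>. It reads \<open>\<Sum>\<^sub>m\<^sub>\<le>\<^sub>l b\<^sub>l b\<^sub>m (c\<^sub>l - c\<^sub>m)\<^sup>3 = 1/20\<close>.

  Suppose now that all \<open>a\<^sub>j\<close> are nonnegative. Then the \<open>c\<^sub>k\<close> are nondecreasing and lie in \<open>[0, 1]\<close>, and the
  last condition becomes \<open>\<Sum>\<^sub>i\<^sub>,\<^sub>j b\<^sub>i b\<^sub>j \<bar>c\<^sub>i - c\<^sub>j\<bar>\<^sup>3 = 1/10\<close>: the rule reproduces the energy of
  Lebesgue measure for the kernel \<open>\<bar>x - y\<bar>\<^sup>3\<close>. This kernel is conditionally positive definite.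
  Indeed, if \<open>\<mu>\<close> is the difference of the rule and Lebesgue measure, its vanishing moments
  kill the cross terms, and the surplus of energy is \<open>12 \<integral> g\<^sup>2\<close> for the function
  \<open>g\<close> with \<open>g'' = \<mu>\<close>. As a piecewise linear function is not equal to a quadratic one,
  \<open>g\<close> does not vanish, and the surplus is positive. This is \<open>quadrature_cubic_energy_gt\<close>, and it
  contradicts the order condition.

  The conditions themselves (\<open>order_conditions\<close>) are read off from one pair of \<open>10 \<times> 10\<close> matrices.
  Consider a path whose edges are labelled by the word \<open>B A A A B A A A A\<close>, and let \<open>A\<close> and \<open>B\<close> be
  the adjacency matrices of the edges with these labels. The entry of a product of exponentials
  between two vertices of the path is the coefficient of the word that lies between them. There
  are always at least two edges \<open>A\<close> between two edges \<open>B\<close>, hence \<open>B\<^sup>2 = 0\<close> and \<open>B A B = 0\<close>, and so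
  \<open>[B, [B, A]] = 0\<close>. The subwords \<open>A\<close>, \<open>B A\<^sup>n\<close> with \<open>n \<le> 4\<close>, and \<open>B A A A B\<close> give all the
  conditions above.
\<close>

section \<open>The energy of a quadrature rule for the kernel \<open>\<bar>x - y\<bar>\<^sup>3\<close>\<close>

lemma has_integral_antiderivative:
  fixes f F :: "real \<Rightarrow> real"
  assumes "u \<le> v" "\<And>x. (F has_real_derivative f x) (at x)"
  shows "(f has_integral F v - F u) {u..v}"
  by (rule fundamental_theorem_of_calculus)
     (use assms in \<open>auto simp: has_real_derivative_iff_has_vector_derivative[symmetric]
        intro: DERIV_subset\<close>)

text \<open>The hinge \<open>x \<mapsto> max 0 (c - x)\<close> is the second antiderivative of the point mass at \<open>c\<close> that
  vanishes to the right of \<open>c\<close>. Hence an antiderivative of the integrand is needed only for the formula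
  that is valid on \<open>[0, c]\<close>.\<close>

lemma has_integral_hinge_mult:
  fixes c :: real and f G :: "real \<Rightarrow> real"
  assumes c: "0 \<le> c" "c \<le> 1"
    and G: "\<And>x. (G has_real_derivative (c - x) * f x) (at x)"
    and f': "\<And>x. x \<le> c \<Longrightarrow> f' x = f x"
  shows "((\<lambda>x. max 0 (c - x) * f' x) has_integral G c - G 0) {0..1}"
proof -
  have "((\<lambda>x. max 0 (c - x) * f' x) has_integral G c - G 0) {0..c}"
    by (rule has_integral_eq[OF _ has_integral_antiderivative[OF c(1) G]]) (auto simp: f')
  moreover have "((\<lambda>x. max 0 (c - x) * f' x) has_integral 0) {c..1}"
    by (rule has_integral_is_0) auto
  ultimately show ?thesis
    using has_integral_combine[OF c] by fastforce
qed

lemma has_integral_hinge_quadratic: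
  fixes c :: real
  assumes "0 \<le> c" "c \<le> 1"
  shows "((\<lambda>x. max 0 (c - x) * ((1 - x)\<^sup>2 / 2)) has_integral c^2/4 - c^3/6 + c^4/24) {0..1}"
proof -
  define G where "G x = (c*x - (1 + 2*c)*x^2/2 + (2 + c)*x^3/3 - x^4/4) / 2" for x :: real
  have "(G has_real_derivative (c - x) * ((1 - x)\<^sup>2 / 2)) (at x)" for x
    unfolding G_def
    by (auto intro!: derivative_eq_intros simp: field_simps power2_eq_square power3_eq_cube)
  from has_integral_hinge_mult[OF assms this, of "\<lambda>x. (1 - x)\<^sup>2 / 2"]
  have "((\<lambda>x. max 0 (c - x) * ((1 - x)\<^sup>2 / 2)) has_integral G c - G 0) {0..1}" by simp
  moreover have "G c - G 0 = c^2/4 - c^3/6 + c^4/24"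
    unfolding G_def by (simp add: field_simps power2_eq_square power3_eq_cube power4_eq_xxxx)
  ultimately show ?thesis by simp
qed

text \<open>Up to polynomial terms, which a quadrature rule turns into products of its moments, the Gram
  kernel of the hinge functions is \<open>\<bar>c - e\<bar>\<^sup>3 / 12\<close>.
  This is why \<open>\<bar>c - e\<bar>\<^sup>3\<close> is conditionally positive definite.\<close>

lemma has_integral_hinge_hinge:
  fixes c e :: real
  assumes "c \<in> {0..1}" "e \<in> {0..1}"
  shows "((\<lambda>x. max 0 (c - x) * max 0 (e - x)) has_integral
           (\<bar>c - e\<bar>^3 - c^3 - e^3 + 3*c^2*e + 3*c*e^2) / 12) {0..1}"
  using assms
proof (induction c e rule: linorder_wlog)
  case (le c e)
  define G where "G x = c*e*x - (c + e)*x^2/2 + x^3/3" for x :: real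
  have G: "(G has_real_derivative (c - x) * (e - x)) (at x)" for x
    unfolding G_def by (auto intro!: derivative_eq_intros simp: field_simps power2_eq_square)
  have "((\<lambda>x. max 0 (c - x) * max 0 (e - x)) has_integral G c - G 0) {0..1}"
    by (rule has_integral_hinge_mult[OF _ _ G]) (use le in auto)
  moreover have "G c - G 0 = (\<bar>c - e\<bar>^3 - c^3 - e^3 + 3*c^2*e + 3*c*e^2) / 12"
    using le(1) by (simp add: G_def abs_if field_simps power2_eq_square power3_eq_cube)
  ultimately show ?case by simp
next
  case (sym c e)
  then show ?case by (simp add: abs_minus_commute algebra_simps)
qed

text \<open>To the right of the last node below \<open>1\<close>, only the hinges with node \<open>1\<close> are left, and their sum
  is a multiple of \<open>1 - x\<close>.\<close>

lemma hinge_sum_not_quadratic: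
  fixes w c :: "'i \<Rightarrow> real"
  assumes fin: "finite I" and c: "\<And>i. i \<in> I \<Longrightarrow> c i \<le> 1"
  shows "\<exists>x\<in>{0..1}. (\<Sum>i\<in>I. w i * max 0 (c i - x)) \<noteq> (1 - x)\<^sup>2 / 2"
proof (rule ccontr)
  assume "\<not> ?thesis"
  then have eq: "(\<Sum>i\<in>I. w i * max 0 (c i - x)) = (1 - x)\<^sup>2 / 2" if "x \<in> {0..1}" for x
    using that by blast
  define m where "m = Max (insert 0 {c i |i. i \<in> I \<and> c i < 1})"
  have fin': "finite (insert 0 {c i |i. i \<in> I \<and> c i < 1})"
    using fin by simp
  have m: "0 \<le> m" "m < 1" "\<And>i. i \<in> I \<Longrightarrow> c i < 1 \<Longrightarrow> c i \<le> m"
    unfolding m_def using fin' by (auto intro!: Max_ge)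
  define W where "W = (\<Sum>i | i \<in> I \<and> c i = 1. w i)"
  have lin: "W = (1 - x) / 2" if x: "m \<le> x" "x < 1" for x
  proof -
    have "(\<Sum>i\<in>I. w i * max 0 (c i - x)) = (\<Sum>i\<in>I. if c i = 1 then w i * (1 - x) else 0)"
    proof (rule sum.cong[OF refl])
      fix i assume i: "i \<in> I"
      then have "c i \<le> x \<or> c i = 1" using c[OF i] m(3)[OF i] x by fastforce
      then show "w i * max 0 (c i - x) = (if c i = 1 then w i * (1 - x) else 0)"
        using x by (auto simp: max_def)
    qed
    also have "\<dots> = W * (1 - x)"
      unfolding W_def sum.inter_filter[OF fin] sum_distrib_right by (intro sum.cong) auto
    finally have "W * (1 - x) = (1 - x) / 2 * (1 - x)"
      using eq[of x] x m(1) by (simp add: power2_eq_square)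
    then show ?thesis using x by simp
  qed
  show False using lin[of m] lin[of "(m + 1) / 2"] m by (simp add: field_simps)
qed

text \<open>The value \<open>1/10\<close> is the energy \<open>\<integral>\<integral> \<bar>x - y\<bar>\<^sup>3\<close> of Lebesgue measure on \<open>[0, 1]\<close>. The function
  \<open>g\<close> in the proof is the second antiderivative of the rule minus Lebesgue measure. Its square is
  expanded, and exactness of the rule evaluates everything except the energy of the rule.\<close>

theorem quadrature_cubic_energy_gt:
  fixes w c :: "'i \<Rightarrow> real"
  assumes fin: "finite I" and c: "\<And>i. i \<in> I \<Longrightarrow> c i \<in> {0..1}"
    and moment: "\<And>n. n \<le> 4 \<Longrightarrow> (\<Sum>i\<in>I. w i * c i ^ n) = 1 / real (n + 1)"
  shows "(\<Sum>i\<in>I. \<Sum>j\<in>I. w i * w j * \<bar>c i - c j\<bar> ^ 3) > 1 / 10"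
proof -
  define h where "h i x = max 0 (c i - x)" for i x
  define q where "q x = (1 - x)\<^sup>2 / 2" for x :: real
  define g where "g x = (\<Sum>i\<in>I. w i * h i x) - q x" for x
  define E where "E = (\<Sum>i\<in>I. \<Sum>j\<in>I. w i * w j * \<bar>c i - c j\<bar> ^ 3)"
  have M: "(\<Sum>i\<in>I. w i) = 1" "(\<Sum>i\<in>I. w i * c i) = 1/2" "(\<Sum>i\<in>I. w i * c i ^ 2) = 1/3"
     "(\<Sum>i\<in>I. w i * c i ^ 3) = 1/4" "(\<Sum>i\<in>I. w i * c i ^ 4) = 1/5"
    using moment[of 0] moment[of 1] moment[of 2] moment[of 3] moment[of 4] by simp_all

  \<comment> \<open>the polynomial part of the Gram kernel splits into products of moments\<close>
  define T where "T = (\<lambda>(p, q). \<Sum>i\<in>I. \<Sum>j\<in>I. (w i * c i ^ p) * (w j * c j ^ q))"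
  have T: "T (p, q) = (\<Sum>i\<in>I. w i * c i ^ p) * (\<Sum>j\<in>I. w j * c j ^ q)" for p q
    by (simp add: T_def sum_product)
  have hh: "((\<lambda>x. \<Sum>i\<in>I. \<Sum>j\<in>I. w i * w j * (h i x * h j x)) has_integral
      (\<Sum>i\<in>I. \<Sum>j\<in>I. w i * w j *
        ((\<bar>c i - c j\<bar>^3 - c i^3 - c j^3 + 3*c i^2*c j + 3*c i*c j^2) / 12))) {0..1}"
    unfolding h_def
    by (intro has_integral_sum fin has_integral_mult_right has_integral_hinge_hinge c)
  have "(\<Sum>i\<in>I. \<Sum>j\<in>I. w i * w j *
        ((\<bar>c i - c j\<bar>^3 - c i^3 - c j^3 + 3*c i^2*c j + 3*c i*c j^2) / 12))
      = (E - T (3, 0) - T (0, 3) + 3 * T (2, 1) + 3 * T (1, 2)) / 12"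
    unfolding E_def T_def
    by (simp add: sum_distrib_left sum_divide_distrib sum.distrib[symmetric]
         sum_subtractf[symmetric] diff_divide_distrib[symmetric] add_divide_distrib[symmetric])
       (intro sum.cong refl; simp add: field_simps)
  also have "\<dots> = (E + 1/2) / 12"
    by (simp add: T M)
  finally have hh': "((\<lambda>x. \<Sum>i\<in>I. \<Sum>j\<in>I. w i * w j * (h i x * h j x)) has_integral
      (E + 1/2) / 12) {0..1}" using hh by (simp only:)

  have "((\<lambda>x. \<Sum>i\<in>I. w i * (h i x * q x)) has_integral
      (\<Sum>i\<in>I. w i * (c i^2/4 - c i^3/6 + c i^4/24))) {0..1}"
    unfolding h_def q_def using c
    by (intro has_integral_sum fin has_integral_mult_right has_integral_hinge_quadratic) auto
  also have "(\<Sum>i\<in>I. w i * (c i^2/4 - c i^3/6 + c i^4/24)) =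
     (\<Sum>i\<in>I. w i * c i^2)/4 - (\<Sum>i\<in>I. w i * c i^3)/6 + (\<Sum>i\<in>I. w i * c i^4)/24"
    by (simp add: sum_divide_distrib sum.distrib[symmetric] sum_subtractf[symmetric])
       (intro sum.cong refl; simp add: field_simps)
  also have "\<dots> = 1/20" using M by simp
  finally have hq: "((\<lambda>x. \<Sum>i\<in>I. w i * (h i x * q x)) has_integral 1/20) {0..1}" .

  have "((\<lambda>x::real. (1 - x)^4 / 4) has_integral - ((1 - 1)^5 / 20) - (- ((1 - 0)^5 / 20))) {0..1}"
    by (rule has_integral_antiderivative[where F = "\<lambda>x. - ((1 - x)^5 / 20)"])
       (auto intro!: derivative_eq_intros)
  then have qq: "((\<lambda>x. q x * q x) has_integral 1/20) {0..1}"
    by (simp add: q_def power2_eq_square power4_eq_xxxx field_simps)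

  have "g x * g x = (\<Sum>i\<in>I. \<Sum>j\<in>I. w i * w j * (h i x * h j x))
      - 2 * (\<Sum>i\<in>I. w i * (h i x * q x)) + q x * q x" for x
  proof -
    have "(\<Sum>i\<in>I. \<Sum>j\<in>I. w i * w j * (h i x * h j x)) = (\<Sum>i\<in>I. w i * h i x) * (\<Sum>i\<in>I. w i * h i x)"
      by (simp add: sum_product mult_ac)
    moreover have "(\<Sum>i\<in>I. w i * (h i x * q x)) = (\<Sum>i\<in>I. w i * h i x) * q x"
      by (simp add: sum_distrib_left mult_ac)
    ultimately show ?thesis by (simp add: g_def algebra_simps)
  qed
  moreover have "((\<lambda>x. (\<Sum>i\<in>I. \<Sum>j\<in>I. w i * w j * (h i x * h j x))
      - 2 * (\<Sum>i\<in>I. w i * (h i x * q x)) + q x * q x) has_integral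
      (E + 1/2) / 12 - 2 * (1/20) + 1/20) {0..1}"
    by (intro has_integral_add has_integral_diff has_integral_mult_right hh' hq qq)
  ultimately have "((\<lambda>x. g x * g x) has_integral (E + 1/2) / 12 - 2 * (1/20) + 1/20) {0..1}"
    by (simp only:)
  moreover have "(E + 1/2) / 12 - 2 * (1/20) + 1/20 = (E - 1/10) / 12"
    by (simp add: field_simps)
  ultimately have gg: "((\<lambda>x. g x * g x) has_integral (E - 1/10) / 12) {0..1}"
    by (simp only:)

  have cont: "continuous_on {0..1} (\<lambda>x. g x * g x)"
    unfolding g_def h_def q_def by (intro continuous_intros) auto
  obtain x where x: "x \<in> {0..1}" "g x \<noteq> 0"
    using hinge_sum_not_quadratic[OF fin, of c w] c by (fastforce simp: g_def h_def q_def)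
  have "E - 1/10 \<noteq> 0"
  proof
    assume "E - 1/10 = 0"
    with gg have "((\<lambda>x. g x * g x) has_integral 0) (cbox 0 1)" by simp
    then have "g x * g x = 0"
      using has_integral_0_cbox_imp_0[of 0 1 "\<lambda>x. g x * g x" x] cont x(1) by auto
    with x(2) show False by simp
  qed
  moreover have "E - 1/10 \<ge> 0"
    using has_integral_nonneg[OF gg] by simp
  ultimately show ?thesis by (simp add: E_def)
qed


section \<open>Exponentials of chain matrices\<close>

text \<open>The edges of the path \<open>0 \<rightarrow> 1 \<rightarrow> \<dots> \<rightarrow> d - 1\<close> are named by their left end points; \<open>chain E d\<close>
  is the adjacency matrix of the edges in \<open>E\<close>.\<close>

definition chain :: "nat set \<Rightarrow> nat \<Rightarrow> real mat" where
  "chain E d = Matrix.mat d d (\<lambda>(i, j). if j = Suc i \<and> i \<in> E then 1 else 0)"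

lemma chain_carrier [simp]: "chain E d \<in> carrier_mat d d"
  by (simp add: chain_def)

lemma chain_dim [simp]: "dim_row (chain E d) = d" "dim_col (chain E d) = d"
  by (simp_all add: chain_def)

lemma chain_index:
  assumes "i < d" "j < d"
  shows "chain E d $$ (i, j) = (if j = Suc i \<and> i \<in> E then 1 else 0)"
  using assms by (simp add: chain_def)

lemma smult_chain_pow:
  assumes "i < d" "j < d"
  shows "((x \<cdot>\<^sub>m chain E d) ^\<^sub>m k) $$ (i, j) = (if j = i + k \<and> {i..<j} \<subseteq> E then x ^ k else 0)"
  using assms
proof (induction k arbitrary: j)
  case 0
  then show ?case by auto
next
  case (Suc k)
  have pc: "(x \<cdot>\<^sub>m chain E d) ^\<^sub>m k \<in> carrier_mat d d" by simp
  have "((x \<cdot>\<^sub>m chain E d) ^\<^sub>m Suc k) $$ (i, j) =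
      (\<Sum>l<d. ((x \<cdot>\<^sub>m chain E d) ^\<^sub>m k) $$ (i, l) * (x * (if j = Suc l \<and> l \<in> E then 1 else 0)))"
    using pc Suc.prems by (simp add: scalar_prod_def chain_def atLeast0LessThan)
  also have "\<dots> = (\<Sum>l<d. if l = i + k then
      (if j = Suc l \<and> l \<in> E \<and> {i..<l} \<subseteq> E then x ^ Suc k else 0) else 0)"
    using Suc by (intro sum.cong) auto
  also have "\<dots> = (if j = i + Suc k \<and> {i..<j} \<subseteq> E then x ^ Suc k else 0)"
    using Suc.prems by (auto simp: atLeastLessThanSuc)
  finally show ?case .
qed

text \<open>This is the entry of the exponential of \<open>x\<close> times a chain matrix: the only walk from \<open>i\<close> to \<open>j\<close>
  is the run of edges between them, and it has to stay in \<open>E\<close>.\<close>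

definition walk_weight :: "real \<Rightarrow> nat set \<Rightarrow> nat \<Rightarrow> nat \<Rightarrow> real" where
  "walk_weight x E i j = (if i \<le> j \<and> {i..<j} \<subseteq> E then x ^ (j - i) / fact (j - i) else 0)"

lemma mat_exp_smult_chain:
  assumes "i < d" "j < d"
  shows "mat_exp (x \<cdot>\<^sub>m chain E d) $$ (i, j) = walk_weight x E i j"
proof -
  have "(\<Sum>k. ((x \<cdot>\<^sub>m chain E d) ^\<^sub>m k) $$ (i, j) / fact k) =
      (\<Sum>k\<in>{j - i}. if j = i + k \<and> {i..<j} \<subseteq> E then x ^ k / fact k else 0)"
    using assms by (subst suminf_finite[of "{j - i}"]) (auto simp: smult_chain_pow)
  then show ?thesis
    using assms by (simp add: mat_exp_def walk_weight_def)
qed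

lemma mat_exp_dim [simp]: "dim_row (mat_exp X) = dim_row X" "dim_col (mat_exp X) = dim_row X"
  by (simp_all add: mat_exp_def)

lemma chain_mult:
  assumes "i < d" "j < d"
  shows "(chain E d * chain F d) $$ (i, j) = (if j = i + 2 \<and> i \<in> E \<and> Suc i \<in> F then 1 else 0)"
proof -
  have "(chain E d * chain F d) $$ (i, j) = (\<Sum>l<d. chain E d $$ (i, l) * chain F d $$ (l, j))"
    using assms by (simp add: scalar_prod_def atLeast0LessThan)
  also have "\<dots> = (\<Sum>l<d. if l = Suc i then (if j = i + 2 \<and> i \<in> E \<and> Suc i \<in> F then 1 else 0) else 0)"
    using assms by (intro sum.cong refl) (auto simp: chain_index)
  finally show ?thesis using assms by auto
qed

text \<open>Expanding the double commutator gives \<open>B\<^sup>2 A - 2 B A B + A B\<^sup>2\<close>. Every entry of \<open>B\<^sup>2\<close> needs two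
  adjacent edges of \<open>E\<close>, and every entry of \<open>B A B\<close> needs two edges of \<open>E\<close> at distance two.\<close>

lemma chain_commutator:
  assumes "\<forall>i\<in>E. Suc i \<notin> E \<and> i + 2 \<notin> E"
  shows "commutator (chain E d) (commutator (chain E d) (chain F d)) = 0\<^sub>m d d"
proof -
  let ?B = "chain E d" and ?A = "chain F d"
  have BB: "?B * ?B = 0\<^sub>m d d"
    using assms by (intro eq_matI) (auto simp del: index_mult_mat(1) simp: chain_mult)
  have BAB: "?B * ?A * ?B = 0\<^sub>m d d"
  proof (rule eq_matI)
    fix i j assume ij: "i < dim_row (0\<^sub>m d d)" "j < dim_col (0\<^sub>m d d)"
    have "(?B * ?A * ?B) $$ (i, j) = (\<Sum>l<d. (?B * ?A) $$ (i, l) * ?B $$ (l, j))"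
      using ij by (simp add: scalar_prod_def atLeast0LessThan)
    also have "\<dots> = 0"
      using ij assms
      by (intro sum.neutral) (auto simp del: index_mult_mat(1) simp: chain_mult chain_index)
    finally show "(?B * ?A * ?B) $$ (i, j) = 0\<^sub>m d d $$ (i, j)" using ij by simp
  qed auto
  have "commutator ?B (commutator ?B ?A) =
      (?B * (?B * ?A) - ?B * (?A * ?B)) - (?B * ?A * ?B - ?A * ?B * ?B)"
    unfolding commutator_def
    by (simp add: mult_minus_distrib_mat[of _ d d _ d] minus_mult_distrib_mat[of _ d d _ _ d]
        mult_carrier_mat[of _ d d _ d])
  also have "?B * (?B * ?A) = 0\<^sub>m d d"
    using BB by (simp add: assoc_mult_mat[of _ d d _ d _ d, symmetric])
  also have "?B * (?A * ?B) = 0\<^sub>m d d"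
    using BAB by (simp add: assoc_mult_mat[of _ d d _ d _ d])
  also have "?A * ?B * ?B = 0\<^sub>m d d"
    using BB by (simp add: assoc_mult_mat[of _ d d _ d _ d])
  also have "?B * ?A * ?B = 0\<^sub>m d d" by (rule BAB)
  also have "0\<^sub>m d d - 0\<^sub>m d d - (0\<^sub>m d d - 0\<^sub>m d d) = (0\<^sub>m d d :: real mat)"
    by (intro eq_matI) auto
  finally show ?thesis .
qed

lemma binomial_exp_sum:
  fixes x y :: real
  assumes "i \<le> j"
  shows "(\<Sum>m=i..j. x ^ (m - i) / fact (m - i) * (y ^ (j - m) / fact (j - m)))
           = (x + y) ^ (j - i) / fact (j - i)"
proof -
  have "(\<Sum>m=i..j. x ^ (m - i) / fact (m - i) * (y ^ (j - m) / fact (j - m))) =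
      (\<Sum>k\<le>j - i. x ^ k / fact k * (y ^ (j - i - k) / fact (j - i - k)))"
    by (rule sum.reindex_bij_witness[of _ "\<lambda>k. i + k" "\<lambda>m. m - i"]) (use assms in auto)
  also have "\<dots> = (x + y) ^ (j - i) / fact (j - i)"
    using exp_series_add_commuting[of x y "j - i"] by (simp add: field_simps)
  finally show ?thesis .
qed

text \<open>The next three lemmas apply the exponential of a chain matrix to a vector \<open>v\<close>. From \<open>i\<close> one can
  cross the single edge \<open>i\<close>, no edge at all, or all the edges up to \<open>r\<close>. The last case requires that
  \<open>r\<close> ends the run, or that \<open>v\<close> vanishes beyond it.\<close>

lemma sum_walk_weight_isolated:
  assumes "i \<in> E" "Suc i \<notin> E" "Suc i < d"
  shows "(\<Sum>l<d. walk_weight x E i l * v l) = v i + x * v (Suc i)"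
proof -
  have "(\<Sum>l<d. walk_weight x E i l * v l) = (\<Sum>l\<in>{i, Suc i}. walk_weight x E i l * v l)"
    using assms by (intro sum.mono_neutral_right) (auto simp: walk_weight_def subset_iff)
  then show ?thesis using assms by (simp add: walk_weight_def)
qed

lemma sum_walk_weight_blocked:
  assumes "i \<notin> E" "i < d"
  shows "(\<Sum>l<d. walk_weight x E i l * v l) = v i"
proof -
  have "(\<Sum>l<d. walk_weight x E i l * v l) = (\<Sum>l\<in>{i}. walk_weight x E i l * v l)"
    using assms by (intro sum.mono_neutral_right) (auto simp: walk_weight_def subset_iff)
  then show ?thesis by (simp add: walk_weight_def)
qed

lemma sum_walk_weight_run:
  assumes "i \<le> r" "{i..<r} \<subseteq> F" "r < d" and "r \<notin> F \<or> (\<forall>m. r < m \<and> m < d \<longrightarrow> v m = 0)"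
  shows "(\<Sum>l<d. walk_weight x F i l * v l) = (\<Sum>l=i..r. x ^ (l - i) / fact (l - i) * v l)"
proof -
  have "(\<Sum>l<d. walk_weight x F i l * v l) = (\<Sum>l=i..r. walk_weight x F i l * v l)"
  proof (rule sum.mono_neutral_right)
    show "\<forall>l\<in>{..<d} - {i..r}. walk_weight x F i l * v l = 0"
    proof
      fix l assume l: "l \<in> {..<d} - {i..r}"
      have "\<not> {i..<l} \<subseteq> F" if "i \<le> l" "r \<notin> F"
      proof -
        have "r \<in> {i..<l}" using that l assms(1) by simp
        then show ?thesis using that(2) by blast
      qed
      with l assms(4) show "walk_weight x F i l * v l = 0"
        by (auto simp: walk_weight_def)
    qed
  qed (use assms in auto)
  also have "\<dots> = (\<Sum>l=i..r. x ^ (l - i) / fact (l - i) * v l)"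
    using assms(2) by (intro sum.cong) (auto simp: walk_weight_def subset_iff)
  finally show ?thesis .
qed

section \<open>The splitting method on a chain\<close>

lemma splitting_carrier:
  assumes "A \<in> carrier_mat d d" "B \<in> carrier_mat d d"
  shows "splitting a b A B \<tau> k \<in> carrier_mat d d"
  using assms by (induction k) (auto intro!: mult_carrier_mat[of _ d d] carrier_matI)

text \<open>Edges in \<open>E\<close> belong to \<open>B\<close> and all the others to \<open>A\<close>. No two edges of \<open>E\<close> are adjacent, so the
  exponential series of \<open>B\<close> stops after its linear term, and a stage crosses at most one edge of \<open>E\<close>.\<close>

context
  fixes E :: "nat set" and d :: nat and a b :: "nat \<Rightarrow> real" and \<tau> :: real
  assumes isolated: "\<forall>i\<in>E. Suc i \<notin> E" and edge: "\<forall>i\<in>E. Suc i < d"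
begin

abbreviation S where "S k i j \<equiv> splitting a b (chain (- E) d) (chain E d) \<tau> k $$ (i, j)"
abbreviation node where "node k \<equiv> \<Sum>l=1..k. a l"

lemma splitting_chain_Suc:
  assumes "i < d" "j < d"
  shows "S (Suc k) i j = (\<Sum>l<d. walk_weight (b (Suc k) * \<tau>) E i l *
           (\<Sum>m<d. walk_weight (a (Suc k) * \<tau>) (- E) l m * S k m j))"
proof -
  let ?P = "splitting a b (chain (- E) d) (chain E d) \<tau> k"
  let ?B = "mat_exp ((b (Suc k) * \<tau>) \<cdot>\<^sub>m chain E d)"
  let ?A = "mat_exp ((a (Suc k) * \<tau>) \<cdot>\<^sub>m chain (- E) d)"
  have P: "?P \<in> carrier_mat d d" by (simp add: splitting_carrier)
  have A: "?A \<in> carrier_mat d d" and B: "?B \<in> carrier_mat d d"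
    by (auto intro!: carrier_matI)
  have "S (Suc k) i j = (?B * (?A * ?P)) $$ (i, j)"
    using assoc_mult_mat[OF B A P] by simp
  also have "\<dots> = (\<Sum>l<d. ?B $$ (i, l) * (\<Sum>m<d. ?A $$ (l, m) * ?P $$ (m, j)))"
    using assms P A B by (simp add: scalar_prod_def atLeast0LessThan)
  finally show ?thesis
    using assms by (simp add: mat_exp_smult_chain)
qed

lemma splitting_chain_drift:
  assumes "i \<notin> E" "i < d" "j < d"
  shows "S (Suc k) i j = (\<Sum>m<d. walk_weight (a (Suc k) * \<tau>) (- E) i m * S k m j)"
  using assms by (simp del: splitting.simps add: splitting_chain_Suc sum_walk_weight_blocked)

lemma splitting_chain_kick_Suc:
  assumes "i \<in> E" "j < d"
  shows "S (Suc k) i j = S k i j + b (Suc k) * \<tau> * S (Suc k) (Suc i) j"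
proof -
  have i: "Suc i \<notin> E" "Suc i < d" "i < d" using assms isolated edge by (auto dest: Suc_lessD)
  define u where "u l = (\<Sum>m<d. walk_weight (a (Suc k) * \<tau>) (- E) l m * S k m j)" for l
  have "S (Suc k) i j = u i + b (Suc k) * \<tau> * u (Suc i)"
    using assms i by (simp del: splitting.simps
        add: splitting_chain_Suc u_def[symmetric] sum_walk_weight_isolated)
  moreover have "u i = S k i j"
    using assms i by (simp add: u_def sum_walk_weight_blocked)
  moreover have "u (Suc i) = S (Suc k) (Suc i) j"
    using assms i by (simp del: splitting.simps add: u_def splitting_chain_drift)
  ultimately show ?thesis by (simp only:)
qed

text \<open>A walk that starts with the \<open>B\<close>-edge at \<open>i\<close> crosses it in exactly one stage \<open>l\<close>. The product
  is read from its left end, so the factors to the left of this kick are idle, and the stages up to \<open>l\<close>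
  carry the rest of the walk. The kick of stage \<open>l\<close> itself may be kept among them, because it does
  nothing at the vertex \<open>Suc i\<close>.\<close>

lemma splitting_chain_kick:
  assumes "i \<in> E" "j < d" "i \<noteq> j"
  shows "S k i j = (\<Sum>l=1..k. b l * \<tau> * S l (Suc i) j)"
proof (induction k)
  case 0
  have "i < d" using bspec[OF edge assms(1)] by simp
  then show ?case using assms by simp
next
  case (Suc k)
  then show ?case
    using splitting_chain_kick_Suc[OF assms(1,2)] by (simp del: splitting.simps)
qed

lemma splitting_chain_upper_triangular:
  assumes "i < d" "j < i"
  shows "S k i j = 0"
  using assms
proof (induction k arbitrary: i)
  case 0
  then show ?case by simp
next
  case (Suc k)
  have drift: "S (Suc k) l j = 0" if "l \<notin> E" "l < d" "j < l" for l
  proof -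
    have "walk_weight x (- E) l m * S k m j = 0" if "m < d" for m x
      using Suc.IH[of m] that \<open>j < l\<close> by (cases "l \<le> m") (auto simp: walk_weight_def)
    then have "(\<Sum>m<d. walk_weight x (- E) l m * S k m j) = 0" for x
      by (intro sum.neutral) blast
    then show ?thesis
      using that by (simp del: splitting.simps add: splitting_chain_drift)
  qed
  show ?case
  proof (cases "i \<in> E")
    case True
    then show ?thesis
      using Suc bspec[OF isolated True] bspec[OF edge True] drift[of "Suc i"]
      by (simp del: splitting.simps add: splitting_chain_kick_Suc)
  next
    case False
    then show ?thesis using drift Suc.prems by blast
  qed
qed

text \<open>Without \<open>B\<close>-edges the method is the flow of \<open>A\<close> for the time \<open>c\<^sub>k \<tau>\<close>, and this is the coefficient
  of its exponential series.\<close>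

lemma splitting_chain_drift_run:
  assumes "i \<le> j" "j < d" "{i..<j} \<subseteq> - E"
  shows "S k i j = (node k * \<tau>) ^ (j - i) / fact (j - i)"
  using assms
proof (induction k arbitrary: i)
  case 0
  then show ?case by (auto simp: power_0_left)
next
  case (Suc k)
  show ?case
  proof (cases "i \<in> E")
    case True
    then have "i = j" using Suc.prems by (cases "i < j") auto
    then show ?thesis
      using True Suc splitting_chain_upper_triangular[of "Suc i" j "Suc k"] bspec[OF edge True]
      by (simp del: splitting.simps add: splitting_chain_kick_Suc)
  next
    case False
    have "S (Suc k) i j = (\<Sum>m<d. walk_weight (a (Suc k) * \<tau>) (- E) i m * S k m j)"
      using False Suc.prems by (intro splitting_chain_drift) auto
    also have "\<dots> = (\<Sum>m=i..j. (a (Suc k) * \<tau>) ^ (m - i) / fact (m - i) * S k m j)"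
      using Suc.prems splitting_chain_upper_triangular by (intro sum_walk_weight_run) auto
    also have "\<dots> = (\<Sum>m=i..j. (a (Suc k) * \<tau>) ^ (m - i) / fact (m - i) *
        ((node k * \<tau>) ^ (j - m) / fact (j - m)))"
    proof (rule sum.cong[OF refl])
      fix m assume "m \<in> {i..j}"
      then have "m \<le> j" "{m..<j} \<subseteq> - E" using Suc.prems by (auto simp: subset_iff)
      with Suc.IH[of m] Suc.prems(2)
      show "(a (Suc k) * \<tau>) ^ (m - i) / fact (m - i) * S k m j =
          (a (Suc k) * \<tau>) ^ (m - i) / fact (m - i) * ((node k * \<tau>) ^ (j - m) / fact (j - m))"
        by simp
    qed
    also have "\<dots> = (a (Suc k) * \<tau> + node k * \<tau>) ^ (j - i) / fact (j - i)"
      by (rule binomial_exp_sum[OF Suc.prems(1)])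
    also have "\<dots> = (node (Suc k) * \<tau>) ^ (j - i) / fact (j - i)"
      by (simp add: algebra_simps)
    finally show ?thesis .
  qed
qed

text \<open>The word \<open>A\<^sup>n B\<close>: the kick of stage \<open>l\<close> comes first, and the flow of \<open>A\<close> acts for the remaining
  time \<open>(c\<^sub>k - c\<^sub>l) \<tau>\<close>. The induction adds one more drift to all the earlier kicks. The kick of the new
  stage is followed by no drift and contributes only for \<open>n = 0\<close>, where the power of zero is one.\<close>

lemma splitting_chain_kick_then_drift:
  assumes "i \<le> r" "r \<in> E" "{i..<r} \<subseteq> - E"
  shows "S k i (Suc r) = (\<Sum>l=1..k. b l * \<tau> * (((node k - node l) * \<tau>) ^ (r - i) / fact (r - i)))"
  using assms(1,3)
proof (induction k arbitrary: i)
  case 0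
  then show ?case using bspec[OF edge assms(2)] by simp
next
  case (Suc k)
  have r: "Suc r < d" "r < d" using bspec[OF edge assms(2)] by auto
  show ?case
  proof (cases "i = r")
    case True
    then show ?thesis
      using r assms(2) splitting_chain_drift_run[of "Suc r" "Suc r"]
      by (simp del: splitting.simps sum.cl_ivl_Suc add: splitting_chain_kick)
  next
    case False
    then have i: "i < r" "i \<notin> E" using Suc.prems by (auto simp: subset_iff)
    have "S (Suc k) i (Suc r) =
        (\<Sum>m<d. walk_weight (a (Suc k) * \<tau>) (- E) i m * S k m (Suc r))"
      using i r by (intro splitting_chain_drift) auto
    also have "\<dots> = (\<Sum>m=i..r. (a (Suc k) * \<tau>) ^ (m - i) / fact (m - i) * S k m (Suc r))"
      using Suc.prems r assms(2) by (intro sum_walk_weight_run) auto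
    also have "\<dots> = (\<Sum>m=i..r. \<Sum>l=1..k. b l * \<tau> * ((a (Suc k) * \<tau>) ^ (m - i) / fact (m - i) *
        (((node k - node l) * \<tau>) ^ (r - m) / fact (r - m))))"
    proof (rule sum.cong[OF refl])
      fix m assume "m \<in> {i..r}"
      then have "m \<le> r" "{m..<r} \<subseteq> - E" using Suc.prems by (auto simp: subset_iff)
      from Suc.IH[OF this] show "(a (Suc k) * \<tau>) ^ (m - i) / fact (m - i) * S k m (Suc r) =
        (\<Sum>l=1..k. b l * \<tau> * ((a (Suc k) * \<tau>) ^ (m - i) / fact (m - i) *
          (((node k - node l) * \<tau>) ^ (r - m) / fact (r - m))))"
        by (simp only: sum_distrib_left mult_ac)
    qed
    also have "\<dots> = (\<Sum>l=1..k. b l * \<tau> * (\<Sum>m=i..r. (a (Suc k) * \<tau>) ^ (m - i) / fact (m - i) *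
        (((node k - node l) * \<tau>) ^ (r - m) / fact (r - m))))"
      by (subst sum.swap) (simp only: sum_distrib_left)
    also have "\<dots> = (\<Sum>l=1..k. b l * \<tau> *
        ((a (Suc k) * \<tau> + (node k - node l) * \<tau>) ^ (r - i) / fact (r - i)))"
      using i by (simp only: binomial_exp_sum[OF less_imp_le])
    also have "\<dots> = (\<Sum>l=1..k. b l * \<tau> *
        (((node (Suc k) - node l) * \<tau>) ^ (r - i) / fact (r - i)))"
      by (simp add: algebra_simps)
    also have "\<dots> = (\<Sum>l=1..Suc k. b l * \<tau> *
        (((node (Suc k) - node l) * \<tau>) ^ (r - i) / fact (r - i)))"
      using i by simp
    finally show ?thesis .
  qed
qed

end

section \<open>Order conditions\<close>

lemma bigo_monomial_imp_zero:
  fixes K :: real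
  assumes "(\<lambda>t. K * t ^ n) \<in> O[at 0](\<lambda>t. t ^ m)" and "n < m"
  shows "K = 0"
proof (rule ccontr)
  assume K: "K \<noteq> 0"
  have "(\<lambda>t::real. t ^ n * t ^ (m - n)) \<in> o[at 0](\<lambda>t. t ^ n * 1)"
  proof (rule landau_o.big_small_mult)
    show "(\<lambda>t::real. t ^ (m - n)) \<in> o[at 0](\<lambda>_. 1)"
      using assms(2) by (intro smalloI_tendsto) (auto intro!: tendsto_eq_intros)
  qed auto
  then have "(\<lambda>t::real. t ^ m) \<in> o[at 0](\<lambda>t. t ^ n)"
    using assms(2) by (simp add: power_add[symmetric])
  with assms(1) have "(\<lambda>t. K * t ^ n) \<in> o[at 0](\<lambda>t. t ^ n)"
    by (rule landau_o.big_small_trans)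
  with K have "(\<lambda>t::real. t ^ n) \<in> o[at 0](\<lambda>t. t ^ n)"
    by (simp add: landau_o.small.cmult_in_iff)
  then have "eventually (\<lambda>t::real. t ^ n = 0) (at 0)"
    by (simp add: landau_o.small_refl_iff)
  moreover have "eventually (\<lambda>t::real. t \<noteq> 0) (at 0)" by (simp add: eventually_at_filter)
  ultimately have "eventually (\<lambda>t::real. False) (at 0)" by eventually_elim simp
  then show False by simp
qed

text \<open>On a chain each entry of the method is homogeneous in \<open>\<tau>\<close>, with degree equal to the distance of
  the two vertices. The error estimate thus turns into an equation of coefficients as long as this
  distance is at most the order.\<close>

lemma has_order_chain_entry:
  assumes order: "has_order_BBA TYPE(real) s a b p"
    and gap: "\<forall>i\<in>E. Suc i \<notin> E \<and> i + 2 \<notin> E"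
    and ij: "i \<le> j" "j < d" "j - i \<le> p"
    and K: "\<And>\<tau>. splitting a b (chain (- E) d) (chain E d) \<tau> s $$ (i, j) = K * \<tau> ^ (j - i)"
  shows "K = 1 / fact (j - i)"
proof -
  let ?A = "chain (- E) d" and ?B = "chain E d"
  have AB: "?A + ?B = chain UNIV d"
    by (rule eq_matI) (auto simp: chain_index)
  have "d \<ge> 1" "i < d" using ij by auto
  then have "(\<lambda>\<tau>. (splitting a b ?A ?B \<tau> s - mat_exp (of_real \<tau> \<cdot>\<^sub>m (?A + ?B))) $$ (i, j))
      \<in> O[at 0](\<lambda>\<tau>. of_real \<tau> ^ (p + 1))"
    using order[unfolded has_order_BBA_def, rule_format, of d ?A ?B i j]
      chain_commutator[OF gap] ij(2) by simp
  also have "(\<lambda>\<tau>. (splitting a b ?A ?B \<tau> s - mat_exp (of_real \<tau> \<cdot>\<^sub>m (?A + ?B))) $$ (i, j))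
      = (\<lambda>\<tau>. (K - 1 / fact (j - i)) * \<tau> ^ (j - i))"
    using ij by (auto simp: AB K mat_exp_smult_chain walk_weight_def algebra_simps)
  finally have "(\<lambda>\<tau>. (K - 1 / fact (j - i)) * \<tau> ^ (j - i)) \<in> O[at 0](\<lambda>\<tau>. \<tau> ^ (p + 1))"
    by simp
  from bigo_monomial_imp_zero[OF this] show ?thesis using ij by simp
qed

text \<open>The three conditions are the coefficients of the words \<open>A\<close>, \<open>B A\<^sup>n\<close> and \<open>B A A A B\<close>. For the exact
  flow, the coefficient of a word of length \<open>q\<close> is \<open>1 / fact q\<close>.\<close>

lemma order_conditions:
  assumes order: "has_order_BBA TYPE(real) s a b p" and p: "p \<ge> 5"
  defines "c \<equiv> \<lambda>k. \<Sum>l=1..k. a l"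
  shows "c s = 1"
    and "\<And>n. n \<le> 4 \<Longrightarrow> (\<Sum>l=1..s. b l * c l ^ n) = 1 / real (n + 1)"
    and "(\<Sum>l=1..s. \<Sum>m=1..l. b l * b m * (c l - c m) ^ 3) = 1 / 20"
proof -
  \<comment> \<open>the path \<open>B A A A B A A A A\<close>: nine edges, of which number \<open>0\<close> and number \<open>4\<close> are labelled \<open>B\<close>\<close>
  define E :: "nat set" where "E = {0, 4}"
  let ?S = "\<lambda>k \<tau>. splitting a b (chain (- E) 10) (chain E 10) \<tau> k"
  have E: "0 \<in> E" "4 \<in> E" and gap: "\<forall>i\<in>E. Suc i \<notin> E \<and> i + 2 \<notin> E"
    and isolated: "\<forall>i\<in>E. Suc i \<notin> E" and edge: "\<forall>i\<in>E. Suc i < 10"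
    by (auto simp: E_def)
  have run: "{1..<4} \<subseteq> - E" "{5..<j} \<subseteq> - E" for j
    by (auto simp: E_def)
  have c: "(\<Sum>l=1..k. a l) = c k" for k
    by (simp add: c_def)
  note entry = has_order_chain_entry[OF order gap, where d = 10]
  note drift = splitting_chain_drift_run[OF isolated edge, where a = a and b = b, unfolded c]
  note kick = splitting_chain_kick[OF isolated edge, where a = a and b = b]
  note kick_drift = splitting_chain_kick_then_drift[OF isolated edge _ E(2),
      where a = a and b = b, unfolded c]

  have "?S s \<tau> $$ (5, 6) = c s * \<tau> ^ (6 - 5)" for \<tau>
    using drift[OF _ _ run(2), of 6] by simp
  from entry[OF _ _ _ this] p show "c s = 1" by simp

  show "(\<Sum>l=1..s. b l * c l ^ n) = 1 / real (n + 1)" if n: "n \<le> 4" for n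
  proof -
    have "?S s \<tau> $$ (4, 5 + n) = (\<Sum>l=1..s. b l * c l ^ n) / fact n * \<tau> ^ (5 + n - 4)" for \<tau>
    proof -
      have "?S s \<tau> $$ (4, 5 + n) = (\<Sum>l=1..s. b l * \<tau> * ?S l \<tau> $$ (5, 5 + n))"
        using n kick[OF E(2), of "5 + n"] by simp
      also have "\<dots> = (\<Sum>l=1..s. b l * \<tau> * ((c l * \<tau>) ^ n / fact n))"
        using n drift[OF _ _ run(2), of "5 + n"] by simp
      finally show ?thesis
        by (simp add: sum_distrib_left sum_divide_distrib power_mult_distrib mult_ac)
    qed
    from entry[OF _ _ _ this] n p
    have "(\<Sum>l=1..s. b l * c l ^ n) / fact n = 1 / fact (Suc n)" by simp
    then have "(\<Sum>l=1..s. b l * c l ^ n) = fact n / fact (Suc n)"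
      by (simp add: field_simps del: fact_Suc)
    then show ?thesis by simp
  qed

  have "?S s \<tau> $$ (0, 5) =
      (\<Sum>l=1..s. \<Sum>m=1..l. b l * b m * (c l - c m) ^ 3) / 6 * \<tau> ^ (5 - 0)" for \<tau>
  proof -
    have "?S s \<tau> $$ (0, 5) = (\<Sum>l=1..s. b l * \<tau> * ?S l \<tau> $$ (1, 5))"
      using kick[OF E(1), of 5] by simp
    also have "\<dots> = (\<Sum>l=1..s. b l * \<tau> * (\<Sum>m=1..l. b m * \<tau> * (((c l - c m) * \<tau>) ^ 3 / 6)))"
      using kick_drift[OF _ run(1)] by (simp add: fact_numeral)
    also have "\<dots> = (\<Sum>l=1..s. \<Sum>m=1..l. b l * b m * (c l - c m) ^ 3) / 6 * \<tau> ^ (5 - 0)"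
      by (simp add: sum_distrib_left sum_distrib_right sum_divide_distrib)
        (intro sum.cong refl; simp add: power_mult_distrib eval_nat_numeral)
    finally show ?thesis .
  qed
  from entry[OF _ _ _ this] p
  have "(\<Sum>l=1..s. \<Sum>m=1..l. b l * b m * (c l - c m) ^ 3) / 6 = 1 / fact 5" by simp
  then show "(\<Sum>l=1..s. \<Sum>m=1..l. b l * b m * (c l - c m) ^ 3) = 1 / 20"
    by (simp add: fact_numeral)
qed

section \<open>The order barrier\<close>

lemma sum_symmetric_square:
  fixes f :: "nat \<Rightarrow> nat \<Rightarrow> real"
  assumes sym: "\<And>i j. f i j = f j i" and diag: "\<And>i. f i i = 0"
  shows "(\<Sum>i=1..n. \<Sum>j=1..n. f i j) = 2 * (\<Sum>i=1..n. \<Sum>j=1..i. f i j)"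
proof (induction n)
  case (Suc n)
  have "(\<Sum>i=1..n. f i (Suc n)) = (\<Sum>j=1..n. f (Suc n) j)" by (rule sum.cong[OF refl sym])
  with Suc show ?case by (simp add: sum.distrib diag)
qed simp

theorem theorem3:
  fixes s p :: nat and a b :: "nat \<Rightarrow> real"
  assumes "s \<ge> 1"
    and "p \<ge> 5"
    and "has_order_BBA TYPE(real) s a b p"
    and "has_order_BBA TYPE(complex) s a b p"
  shows "\<exists>j\<in>{1..s}. a j < 0"
proof (rule ccontr)
  assume "\<not> ?thesis"
  then have a: "a j \<ge> 0" if "j \<in> {1..s}" for j
    using that by (meson not_le)
  define c where "c k = (\<Sum>l=1..k. a l)" for k
  note cond = order_conditions[OF assms(3,2), folded c_def]
  have mono: "c k \<le> c l" if "k \<le> l" "l \<le> s" for k l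
    unfolding c_def using that a by (intro sum_mono2) auto
  have c: "c k \<in> {0..1}" if "k \<in> {1..s}" for k
    using mono[of 0 k] mono[of k s] that cond(1) by (simp add: c_def)
  have "1 / 10 < (\<Sum>i=1..s. \<Sum>j=1..s. b i * b j * \<bar>c i - c j\<bar> ^ 3)"
    using c cond(2) by (intro quadrature_cubic_energy_gt) auto
  also have "\<dots> = 2 * (\<Sum>i=1..s. \<Sum>j=1..i. b i * b j * \<bar>c i - c j\<bar> ^ 3)"
    by (rule sum_symmetric_square) (simp_all add: abs_minus_commute mult.commute)
  also have "(\<Sum>i=1..s. \<Sum>j=1..i. b i * b j * \<bar>c i - c j\<bar> ^ 3) =
      (\<Sum>i=1..s. \<Sum>j=1..i. b i * b j * (c i - c j) ^ 3)"
    using mono by (intro sum.cong refl) auto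
  also have "\<dots> = 1 / 20" by (rule cond(3))
  finally show False by simp
qed

end
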